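(* Let $\mathsf{JL}$ be one of the justification logics $\mathsf{J},\mathsf{J4},\mathsf{JD},\mathsf{JD4},\mathsf{JT},\mathsf{LP}$, and let $\mathsf{CS}$ be a finite constant specification for $\mathsf{JL}$. If a sequent $\Gamma\Rightarrow\Delta$ is valid in every $\mathsf{JL}_{\mathsf{CS}}$-model, then it is derivable in $\mathsf{G3JL}_{\mathsf{CS}}$.
   Context: Justification logics. Terms are built from justification variables and constants by binary $\cdot,+$ and, if (j4) is an axiom, unary $!$. Formulas are built from propositional variables and $\bot$ by $\neg,\wedge,\vee,\to$ and $t:A$. $Tm$, $Fm$ are the sets of terms and formulas. $\mathsf J$ has axiom schemes: propositional tautologies; $s:A\to(s+t):A$, $s:A\to(t+s):A$; $s:(A\to B)\to(t:A\to(s\cdot t):B)$. Further schemes: (jT) $t:A\to A$, (jD) $t:\bot\to\bot$, (j4) $t:A\to\,!t:t:A$. The names list the added schemes, $\mathsf{LP}=\mathsf{JT4}$. A constant specification $\mathsf{CS}$: if (j4) is not an axiom, a set of formulas $c_n:\dots:c_1:A$ ($n\ge1$, $c_j$ constants, $A$ an axiom instance), closed under passing from $c_n:c_{n-1}:\dots:c_1:A$ to $c_{n-1}:\dots:c_1:A$; if (j4) is an axiom, a set of formulas $c:A$ ($c$ a constant, $A$ an axiom instance). Models. A $\mathsf{JL}_{\mathsf{CS}}$-model (Fitting model) is $\mathcal M=(\mathcal W,\mathcal R,\mathcal E,\mathcal V)$ with $\mathcal W\neq\emptyset$, $\mathcal R\subseteq\mathcal W\times\mathcal W$, $\mathcal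 V$ a map from propositional variables to subsets of $\mathcal W$, and $\mathcal E:Tm\times Fm\to2^{\mathcal W}$ with $\mathcal E(c,F)=\mathcal W$ for each $c:F\in\mathsf{CS}$. Forcing: $(\mathcal M,w)\Vdash P$ iff $w\in\mathcal V(P)$; Boolean connectives are classical; $(\mathcal M,w)\Vdash t:F$ iff $w\in\mathcal E(t,F)$ and $(\mathcal M,v)\Vdash F$ for all $v$ with $w\mathcal Rv$. Conditions: $\mathcal E(s,A\to B)\cap\mathcal E(t,A)\subseteq\mathcal E(s\cdot t,B)$; $\mathcal E(s,A)\cup\mathcal E(t,A)\subseteq\mathcal E(s+t,A)$; if (jT) is an axiom, $\mathcal R$ is reflexive; if (jD), $\mathcal R$ is serial; if (j4), $\mathcal R$ is transitive, $w\in\mathcal E(t,A)$ and $w\mathcal Rv$ imply $v\in\mathcal E(t,A)$, and $\mathcal E(t,A)\subseteq\mathcal E(!t,t:A)$. Calculus $\mathsf{G3JL}_{\mathsf{CS}}$. Fix a countably infinite set $L$ of labels $w,v,u,\dots$. The labeled language has labeled formulas $w\Vvdash A$, relational atoms $wRv$ and evidence atoms $wE(t,A)$ ($A$ a formula, $t$ a term). Sequents $\Gamma\Rightarrow\Delta$ consist of finite multisets of these. Initial sequents: $w\Vvdash P,\Gamma\Rightarrow\Delta,w\Vvdash P$ ($P$ a propositional variable); $w\Vvdash\bot,\Gamma\Rightarrow\Delta$; $wRv,\Gamma\Rightarrow\Delta,wRv$; $wE(t,A),\Gamma\Rightarrow\Delta,wE(t,A)$. Rules (premises / conclusion): (L$\neg$)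 $\Gamma\Rightarrow\Delta,w\Vvdash A$ / $w\Vvdash\neg A,\Gamma\Rightarrow\Delta$; (R$\neg$) $w\Vvdash A,\Gamma\Rightarrow\Delta$ / $\Gamma\Rightarrow\Delta,w\Vvdash\neg A$; (L$\wedge$) $w\Vvdash A,w\Vvdash B,\Gamma\Rightarrow\Delta$ / $w\Vvdash A\wedge B,\Gamma\Rightarrow\Delta$; (R$\wedge$) $\Gamma\Rightarrow\Delta,w\Vvdash A$ and $\Gamma\Rightarrow\Delta,w\Vvdash B$ / $\Gamma\Rightarrow\Delta,w\Vvdash A\wedge B$; (L$\vee$) $w\Vvdash A,\Gamma\Rightarrow\Delta$ and $w\Vvdash B,\Gamma\Rightarrow\Delta$ / $w\Vvdash A\vee B,\Gamma\Rightarrow\Delta$; (R$\vee$) $\Gamma\Rightarrow\Delta,w\Vvdash A,w\Vvdash B$ / $\Gamma\Rightarrow\Delta,w\Vvdash A\vee B$; (L$\to$) $\Gamma\Rightarrow\Delta,w\Vvdash A$ and $w\Vvdash B,\Gamma\Rightarrow\Delta$ / $w\Vvdash A\to B,\Gamma\Rightarrow\Delta$; (R$\to$) $w\Vvdash A,\Gamma\Rightarrow\Delta,w\Vvdash B$ / $\Gamma\Rightarrow\Delta,w\Vvdash A\to B$; (L:) $v\Vvdash A,w\Vvdash t:A,wRv,\Gamma\Rightarrow\Delta$ / $w\Vvdash t:A,wRv,\Gamma\Rightarrow\Delta$; (R:) $wRv,wE(t,A),\Gamma\Rightarrow\Delta,v\Vvdash A$ / $wE(t,A),\Gamma\Rightarrow\Delta,w\Vvdash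 t:A$, where the eigenlabel $v$ does not occur in the conclusion; (E) $wE(t,A),w\Vvdash t:A,\Gamma\Rightarrow\Delta$ / $w\Vvdash t:A,\Gamma\Rightarrow\Delta$; (El+) $wE(s+t,A),wE(t,A),\Gamma\Rightarrow\Delta$ / $wE(t,A),\Gamma\Rightarrow\Delta$; (Er+) $wE(t+s,A),wE(t,A),\Gamma\Rightarrow\Delta$ / $wE(t,A),\Gamma\Rightarrow\Delta$; (E$\cdot$) $wE(s\cdot t,B),wE(s,A\to B),wE(t,A),\Gamma\Rightarrow\Delta$ / $wE(s,A\to B),wE(t,A),\Gamma\Rightarrow\Delta$; (IAN)/(AN) $wE(c,F),\Gamma\Rightarrow\Delta$ / $\Gamma\Rightarrow\Delta$, for $c:F\in\mathsf{CS}$ ($c$ a constant). If (jT) is an axiom: (Ref) $wRw,\Gamma\Rightarrow\Delta$ / $\Gamma\Rightarrow\Delta$. If (jD) is an axiom: (Ser) $wRv,\Gamma\Rightarrow\Delta$ / $\Gamma\Rightarrow\Delta$, where the eigenlabel $v$ does not occur in the conclusion. If (j4) is an axiom: (E!) $wE(!t,t:A),wE(t,A),\Gamma\Rightarrow\Delta$ / $wE(t,A),\Gamma\Rightarrow\Delta$; (Mon) $vE(t,A),wE(t,A),wRv,\Gamma\Rightarrow\Delta$ / $wE(t,A),wRv,\Gamma\Rightarrow\Delta$; (Trans) $wRu,wRv,vRu,\Gamma\Rightarrow\Delta$ / $wRv,vRu,\Gamma\Rightarrow\Delta$. Validity. An $\mathcal M$-interpretation is a function $[\cdot]:L\to\mathcal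 W$. It validates $w\Vvdash A$ if $(\mathcal M,[w])\Vdash A$, validates $wRv$ if $[w]\mathcal R[v]$, and validates $wE(t,A)$ if $[w]\in\mathcal E(t,A)$. A sequent $\Gamma\Rightarrow\Delta$ is valid in $\mathcal M$ if every $\mathcal M$-interpretation that validates all formulas of $\Gamma$ validates at least one formula of $\Delta$. *)

theory Defs
  imports Main "HOL-Library.Multiset"
begin

datatype logic = J | J4 | JD | JD4 | JT | LP

definition has_jT :: "logic \<Rightarrow> bool" where
  "has_jT L \<longleftrightarrow> L \<in> {JT, LP}"

definition has_jD :: "logic \<Rightarrow> bool" where
  "has_jD L \<longleftrightarrow> L \<in> {JD, JD4}"

definition has_j4 :: "logic \<Rightarrow> bool" where
  "has_j4 L \<longleftrightarrow> L \<in> {J4, JD4, LP}"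

text \<open>The types of justification variables \<open>'x\<close>, constants \<open>'c\<close> and propositional
  variables \<open>'p\<close> are left arbitrary.\<close>

datatype ('x, 'c) tm =
    JVar 'x
  | JConst 'c
  | App "('x, 'c) tm" "('x, 'c) tm"
  | Plus "('x, 'c) tm" "('x, 'c) tm"
  | Bang "('x, 'c) tm"

datatype ('x, 'c, 'p) fm =
    PVar 'p
  | Bot
  | Neg "('x, 'c, 'p) fm"
  | Con "('x, 'c, 'p) fm" "('x, 'c, 'p) fm"
  | Dis "('x, 'c, 'p) fm" "('x, 'c, 'p) fm"
  | Imp "('x, 'c, 'p) fm" "('x, 'c, 'p) fm"
  | Just "('x, 'c) tm" "('x, 'c, 'p) fm"

text \<open>The language depends on the logic: \<open>Bang\<close> is available only in the presence of (j4).
  The sets \<open>Tm L\<close> and \<open>Fm L\<close> cut out the terms and formulas of the logic \<open>L\<close>.\<close>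

inductive_set Tm :: "logic \<Rightarrow> ('x, 'c) tm set" for L where
  "JVar x \<in> Tm L"
| "JConst c \<in> Tm L"
| "s \<in> Tm L \<Longrightarrow> t \<in> Tm L \<Longrightarrow> App s t \<in> Tm L"
| "s \<in> Tm L \<Longrightarrow> t \<in> Tm L \<Longrightarrow> Plus s t \<in> Tm L"
| "has_j4 L \<Longrightarrow> t \<in> Tm L \<Longrightarrow> Bang t \<in> Tm L"

inductive_set Fm :: "logic \<Rightarrow> ('x, 'c, 'p) fm set" for L where
  "PVar P \<in> Fm L"
| "Bot \<in> Fm L"
| "A \<in> Fm L \<Longrightarrow> Neg A \<in> Fm L"
| "A \<in> Fm L \<Longrightarrow> B \<in> Fm L \<Longrightarrow> Con A B \<in> Fm L"
| "A \<in> Fm L \<Longrightarrow> B \<in> Fm L \<Longrightarrow> Dis A B \<in> Fm L"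
| "A \<in> Fm L \<Longrightarrow> B \<in> Fm L \<Longrightarrow> Imp A B \<in> Fm L"
| "t \<in> Tm L \<Longrightarrow> A \<in> Fm L \<Longrightarrow> Just t A \<in> Fm L"


text \<open>A propositional tautology is a formula that is true under all Boolean valuations of
  its propositional atoms, where formulas \<open>Just t A\<close> count as atoms.\<close>

primrec bool_eval ::
    "('p \<Rightarrow> bool) \<Rightarrow> (('x, 'c) tm \<Rightarrow> ('x, 'c, 'p) fm \<Rightarrow> bool) \<Rightarrow> ('x, 'c, 'p) fm \<Rightarrow> bool" where
  "bool_eval f g (PVar P) \<longleftrightarrow> f P"
| "bool_eval f g Bot \<longleftrightarrow> False"
| "bool_eval f g (Neg A) \<longleftrightarrow> \<not> bool_eval f g A"
| "bool_eval f g (Con A B) \<longleftrightarrow> bool_eval f g A \<and> bool_eval f g B"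
| "bool_eval f g (Dis A B) \<longleftrightarrow> bool_eval f g A \<or> bool_eval f g B"
| "bool_eval f g (Imp A B) \<longleftrightarrow> (bool_eval f g A \<longrightarrow> bool_eval f g B)"
| "bool_eval f g (Just t A) \<longleftrightarrow> g t A"

definition tautology :: "('x, 'c, 'p) fm \<Rightarrow> bool" where
  "tautology A \<longleftrightarrow> (\<forall>f g. bool_eval f g A)"

inductive_set Axioms :: "logic \<Rightarrow> ('x, 'c, 'p) fm set" for L where
  Taut: "A \<in> Fm L \<Longrightarrow> tautology A \<Longrightarrow> A \<in> Axioms L"
| PlusL: "s \<in> Tm L \<Longrightarrow> t \<in> Tm L \<Longrightarrow> A \<in> Fm L \<Longrightarrow>
    Imp (Just s A) (Just (Plus s t) A) \<in> Axioms L"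
| PlusR: "s \<in> Tm L \<Longrightarrow> t \<in> Tm L \<Longrightarrow> A \<in> Fm L \<Longrightarrow>
    Imp (Just s A) (Just (Plus t s) A) \<in> Axioms L"
| Appl: "s \<in> Tm L \<Longrightarrow> t \<in> Tm L \<Longrightarrow> A \<in> Fm L \<Longrightarrow> B \<in> Fm L \<Longrightarrow>
    Imp (Just s (Imp A B)) (Imp (Just t A) (Just (App s t) B)) \<in> Axioms L"
| jT: "has_jT L \<Longrightarrow> t \<in> Tm L \<Longrightarrow> A \<in> Fm L \<Longrightarrow> Imp (Just t A) A \<in> Axioms L"
| jD: "has_jD L \<Longrightarrow> t \<in> Tm L \<Longrightarrow> Imp (Just t Bot) Bot \<in> Axioms L"
| j4: "has_j4 L \<Longrightarrow> t \<in> Tm L \<Longrightarrow> A \<in> Fm L \<Longrightarrow>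
    Imp (Just t A) (Just (Bang t) (Just t A)) \<in> Axioms L"

text \<open>\<open>const_chain [c\<^sub>n, \<dots>, c\<^sub>1] A\<close> is the formula \<open>c\<^sub>n : \<dots> : c\<^sub>1 : A\<close>.\<close>

definition const_chain :: "'c list \<Rightarrow> ('x, 'c, 'p) fm \<Rightarrow> ('x, 'c, 'p) fm" where
  "const_chain cs A = foldr (\<lambda>c F. Just (JConst c) F) cs A"

definition constant_specification :: "logic \<Rightarrow> ('x, 'c, 'p) fm set \<Rightarrow> bool" where
  "constant_specification L CS \<longleftrightarrow>
    (if has_j4 L
     then CS \<subseteq> {Just (JConst c) A |c A. A \<in> Axioms L}
     else CS \<subseteq> {const_chain cs A |cs A. cs \<noteq> [] \<and> A \<in> Axioms L} \<and>
          (\<forall>c cs A. cs \<noteq> [] \<and> A \<in> Axioms L \<and> const_chain (c # cs) A \<in> CS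
             \<longrightarrow> const_chain cs A \<in> CS))"


text \<open>Worlds form a nonempty carrier set inside the type \<open>'w\<close>. Only the values of \<open>evid\<close>
  on \<open>Tm L\<close> and \<open>Fm L\<close> are constrained; its other values never matter.\<close>

record ('w, 'x, 'c, 'p) model =
  worlds :: "'w set"
  acc :: "('w \<times> 'w) set"
  evid :: "('x, 'c) tm \<Rightarrow> ('x, 'c, 'p) fm \<Rightarrow> 'w set"
  val :: "'p \<Rightarrow> 'w set"

definition fitting_model ::
    "logic \<Rightarrow> ('x, 'c, 'p) fm set \<Rightarrow> ('w, 'x, 'c, 'p) model \<Rightarrow> bool" where
  "fitting_model L CS M \<longleftrightarrow>
    worlds M \<noteq> {} \<and>
    acc M \<subseteq> worlds M \<times> worlds M \<and>
    (\<forall>P. val M P \<subseteq> worlds M) \<and>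
    (\<forall>t\<in>Tm L. \<forall>A\<in>Fm L. evid M t A \<subseteq> worlds M) \<and>
    (\<forall>c F. Just (JConst c) F \<in> CS \<longrightarrow> evid M (JConst c) F = worlds M) \<and>
    (\<forall>s\<in>Tm L. \<forall>t\<in>Tm L. \<forall>A\<in>Fm L. \<forall>B\<in>Fm L.
       evid M s (Imp A B) \<inter> evid M t A \<subseteq> evid M (App s t) B) \<and>
    (\<forall>s\<in>Tm L. \<forall>t\<in>Tm L. \<forall>A\<in>Fm L.
       evid M s A \<union> evid M t A \<subseteq> evid M (Plus s t) A) \<and>
    (has_jT L \<longrightarrow> (\<forall>w\<in>worlds M. (w, w) \<in> acc M)) \<and>
    (has_jD L \<longrightarrow> (\<forall>w\<in>worlds M. \<exists>v\<in>worlds M. (w, v) \<in> acc M)) \<and>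
    (has_j4 L \<longrightarrow>
       trans (acc M) \<and>
       (\<forall>t\<in>Tm L. \<forall>A\<in>Fm L. \<forall>w v. w \<in> evid M t A \<and> (w, v) \<in> acc M \<longrightarrow> v \<in> evid M t A) \<and>
       (\<forall>t\<in>Tm L. \<forall>A\<in>Fm L. evid M t A \<subseteq> evid M (Bang t) (Just t A)))"

primrec forces :: "('w, 'x, 'c, 'p) model \<Rightarrow> 'w \<Rightarrow> ('x, 'c, 'p) fm \<Rightarrow> bool" where
  "forces M w (PVar P) \<longleftrightarrow> w \<in> val M P"
| "forces M w Bot \<longleftrightarrow> False"
| "forces M w (Neg A) \<longleftrightarrow> \<not> forces M w A"
| "forces M w (Con A B) \<longleftrightarrow> forces M w A \<and> forces M w B"
| "forces M w (Dis A B) \<longleftrightarrow> forces M w A \<or> forces M w B"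
| "forces M w (Imp A B) \<longleftrightarrow> (forces M w A \<longrightarrow> forces M w B)"
| "forces M w (Just t A) \<longleftrightarrow> w \<in> evid M t A \<and> (\<forall>v. (w, v) \<in> acc M \<longrightarrow> forces M v A)"


text \<open>The countably infinite set of labels is taken to be the set of natural numbers.\<close>

type_synonym label = nat

datatype ('x, 'c, 'p) lfm =
    Lab label "('x, 'c, 'p) fm"
  | Rel label label
  | Ev label "('x, 'c) tm" "('x, 'c, 'p) fm"

primrec labels :: "('x, 'c, 'p) lfm \<Rightarrow> label set" where
  "labels (Lab w A) = {w}"
| "labels (Rel w v) = {w, v}"
| "labels (Ev w t A) = {w}"

definition fresh ::
    "label \<Rightarrow> ('x, 'c, 'p) lfm multiset \<Rightarrow> ('x, 'c, 'p) lfm multiset \<Rightarrow> bool" where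
  "fresh v \<Gamma> \<Delta> \<longleftrightarrow> (\<forall>\<phi> \<in># \<Gamma> + \<Delta>. v \<notin> labels \<phi>)"

primrec lfm_in :: "logic \<Rightarrow> ('x, 'c, 'p) lfm \<Rightarrow> bool" where
  "lfm_in L (Lab w A) \<longleftrightarrow> A \<in> Fm L"
| "lfm_in L (Rel w v) \<longleftrightarrow> True"
| "lfm_in L (Ev w t A) \<longleftrightarrow> t \<in> Tm L \<and> A \<in> Fm L"

text \<open>\<open>sequent L \<Gamma> \<Delta>\<close> says that \<open>\<Gamma> \<Rightarrow> \<Delta>\<close> is a sequent over the labeled language of \<open>L\<close>.\<close>

definition sequent ::
    "logic \<Rightarrow> ('x, 'c, 'p) lfm multiset \<Rightarrow> ('x, 'c, 'p) lfm multiset \<Rightarrow> bool" where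
  "sequent L \<Gamma> \<Delta> \<longleftrightarrow> (\<forall>\<phi> \<in># \<Gamma> + \<Delta>. lfm_in L \<phi>)"

text \<open>The language restriction is imposed on initial sequents only: every rule whose premises
  are sequents over the language of \<open>L\<close> has a conclusion over that language, so all sequents
  in a derivation are over the language of \<open>L\<close> (lemma \<open>G3_sequent\<close>).\<close>

inductive G3 ::
    "logic \<Rightarrow> ('x, 'c, 'p) fm set \<Rightarrow>
     ('x, 'c, 'p) lfm multiset \<Rightarrow> ('x, 'c, 'p) lfm multiset \<Rightarrow> bool"
  for L :: logic and CS :: "('x, 'c, 'p) fm set"
where
  InitP: "sequent L (add_mset (Lab w (PVar P)) \<Gamma>) (add_mset (Lab w (PVar P)) \<Delta>) \<Longrightarrow>
    G3 L CS (add_mset (Lab w (PVar P)) \<Gamma>) (add_mset (Lab w (PVar P)) \<Delta>)"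
| InitBot: "sequent L (add_mset (Lab w Bot) \<Gamma>) \<Delta> \<Longrightarrow>
    G3 L CS (add_mset (Lab w Bot) \<Gamma>) \<Delta>"
| InitR: "sequent L (add_mset (Rel w v) \<Gamma>) (add_mset (Rel w v) \<Delta>) \<Longrightarrow>
    G3 L CS (add_mset (Rel w v) \<Gamma>) (add_mset (Rel w v) \<Delta>)"
| InitE: "sequent L (add_mset (Ev w t A) \<Gamma>) (add_mset (Ev w t A) \<Delta>) \<Longrightarrow>
    G3 L CS (add_mset (Ev w t A) \<Gamma>) (add_mset (Ev w t A) \<Delta>)"
| LNeg: "G3 L CS \<Gamma> (add_mset (Lab w A) \<Delta>) \<Longrightarrow>
    G3 L CS (add_mset (Lab w (Neg A)) \<Gamma>) \<Delta>"
| RNeg: "G3 L CS (add_mset (Lab w A) \<Gamma>) \<Delta> \<Longrightarrow>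
    G3 L CS \<Gamma> (add_mset (Lab w (Neg A)) \<Delta>)"
| LCon: "G3 L CS (add_mset (Lab w A) (add_mset (Lab w B) \<Gamma>)) \<Delta> \<Longrightarrow>
    G3 L CS (add_mset (Lab w (Con A B)) \<Gamma>) \<Delta>"
| RCon: "G3 L CS \<Gamma> (add_mset (Lab w A) \<Delta>) \<Longrightarrow> G3 L CS \<Gamma> (add_mset (Lab w B) \<Delta>) \<Longrightarrow>
    G3 L CS \<Gamma> (add_mset (Lab w (Con A B)) \<Delta>)"
| LDis: "G3 L CS (add_mset (Lab w A) \<Gamma>) \<Delta> \<Longrightarrow> G3 L CS (add_mset (Lab w B) \<Gamma>) \<Delta> \<Longrightarrow>
    G3 L CS (add_mset (Lab w (Dis A B)) \<Gamma>) \<Delta>"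
| RDis: "G3 L CS \<Gamma> (add_mset (Lab w A) (add_mset (Lab w B) \<Delta>)) \<Longrightarrow>
    G3 L CS \<Gamma> (add_mset (Lab w (Dis A B)) \<Delta>)"
| LImp: "G3 L CS \<Gamma> (add_mset (Lab w A) \<Delta>) \<Longrightarrow> G3 L CS (add_mset (Lab w B) \<Gamma>) \<Delta> \<Longrightarrow>
    G3 L CS (add_mset (Lab w (Imp A B)) \<Gamma>) \<Delta>"
| RImp: "G3 L CS (add_mset (Lab w A) \<Gamma>) (add_mset (Lab w B) \<Delta>) \<Longrightarrow>
    G3 L CS \<Gamma> (add_mset (Lab w (Imp A B)) \<Delta>)"
| LJust: "G3 L CS (add_mset (Lab v A) (add_mset (Lab w (Just t A)) (add_mset (Rel w v) \<Gamma>))) \<Delta> \<Longrightarrow>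
    G3 L CS (add_mset (Lab w (Just t A)) (add_mset (Rel w v) \<Gamma>)) \<Delta>"
| RJust: "G3 L CS (add_mset (Rel w v) (add_mset (Ev w t A) \<Gamma>)) (add_mset (Lab v A) \<Delta>) \<Longrightarrow>
    fresh v (add_mset (Ev w t A) \<Gamma>) (add_mset (Lab w (Just t A)) \<Delta>) \<Longrightarrow>
    G3 L CS (add_mset (Ev w t A) \<Gamma>) (add_mset (Lab w (Just t A)) \<Delta>)"
| E: "G3 L CS (add_mset (Ev w t A) (add_mset (Lab w (Just t A)) \<Gamma>)) \<Delta> \<Longrightarrow>
    G3 L CS (add_mset (Lab w (Just t A)) \<Gamma>) \<Delta>"
| ElPlus: "G3 L CS (add_mset (Ev w (Plus s t) A) (add_mset (Ev w t A) \<Gamma>)) \<Delta> \<Longrightarrow>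
    G3 L CS (add_mset (Ev w t A) \<Gamma>) \<Delta>"
| ErPlus: "G3 L CS (add_mset (Ev w (Plus t s) A) (add_mset (Ev w t A) \<Gamma>)) \<Delta> \<Longrightarrow>
    G3 L CS (add_mset (Ev w t A) \<Gamma>) \<Delta>"
| EApp: "G3 L CS (add_mset (Ev w (App s t) B)
      (add_mset (Ev w s (Imp A B)) (add_mset (Ev w t A) \<Gamma>))) \<Delta> \<Longrightarrow>
    G3 L CS (add_mset (Ev w s (Imp A B)) (add_mset (Ev w t A) \<Gamma>)) \<Delta>"
| AN: "Just (JConst c) F \<in> CS \<Longrightarrow> G3 L CS (add_mset (Ev w (JConst c) F) \<Gamma>) \<Delta> \<Longrightarrow>
    G3 L CS \<Gamma> \<Delta>"
| Ref: "has_jT L \<Longrightarrow> G3 L CS (add_mset (Rel w w) \<Gamma>) \<Delta> \<Longrightarrow> G3 L CS \<Gamma> \<Delta>"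
| Ser: "has_jD L \<Longrightarrow> G3 L CS (add_mset (Rel w v) \<Gamma>) \<Delta> \<Longrightarrow> fresh v \<Gamma> \<Delta> \<Longrightarrow> G3 L CS \<Gamma> \<Delta>"
| EBang: "has_j4 L \<Longrightarrow>
    G3 L CS (add_mset (Ev w (Bang t) (Just t A)) (add_mset (Ev w t A) \<Gamma>)) \<Delta> \<Longrightarrow>
    G3 L CS (add_mset (Ev w t A) \<Gamma>) \<Delta>"
| Mon: "has_j4 L \<Longrightarrow>
    G3 L CS (add_mset (Ev v t A) (add_mset (Ev w t A) (add_mset (Rel w v) \<Gamma>))) \<Delta> \<Longrightarrow>
    G3 L CS (add_mset (Ev w t A) (add_mset (Rel w v) \<Gamma>)) \<Delta>"
| Trans: "has_j4 L \<Longrightarrow>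
    G3 L CS (add_mset (Rel w u) (add_mset (Rel w v) (add_mset (Rel v u) \<Gamma>))) \<Delta> \<Longrightarrow>
    G3 L CS (add_mset (Rel w v) (add_mset (Rel v u) \<Gamma>)) \<Delta>"

lemma G3_sequent: "G3 L CS \<Gamma> \<Delta> \<Longrightarrow> sequent L \<Gamma> \<Delta>"
  by (induction rule: G3.induct) (auto simp: sequent_def intro: Fm.intros)


definition interpretation_in :: "('w, 'x, 'c, 'p) model \<Rightarrow> (label \<Rightarrow> 'w) \<Rightarrow> bool" where
  "interpretation_in M i \<longleftrightarrow> (\<forall>l. i l \<in> worlds M)"

primrec validates ::
    "('w, 'x, 'c, 'p) model \<Rightarrow> (label \<Rightarrow> 'w) \<Rightarrow> ('x, 'c, 'p) lfm \<Rightarrow> bool" where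
  "validates M i (Lab w A) \<longleftrightarrow> forces M (i w) A"
| "validates M i (Rel w v) \<longleftrightarrow> (i w, i v) \<in> acc M"
| "validates M i (Ev w t A) \<longleftrightarrow> i w \<in> evid M t A"

definition valid_in ::
    "('w, 'x, 'c, 'p) model \<Rightarrow>
     ('x, 'c, 'p) lfm multiset \<Rightarrow> ('x, 'c, 'p) lfm multiset \<Rightarrow> bool" where
  "valid_in M \<Gamma> \<Delta> \<longleftrightarrow>
    (\<forall>i. interpretation_in M i \<longrightarrow>
      (\<forall>\<phi> \<in># \<Gamma>. validates M i \<phi>) \<longrightarrow> (\<exists>\<psi> \<in># \<Delta>. validates M i \<psi>))"

end

theory Submission
  imports Defs "HOL-Library.Countable_Set"
begin

text \<open>
  If \<open>\<Gamma> \<Rightarrow> \<Delta>\<close> is not derivable, then reading the rules backwards never closes every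
  branch: an underivable conclusion has an underivable premise. Following underivable premises
  fairly, so that every rule instance that becomes applicable is eventually treated, and
  collecting everything that occurs on the way gives a saturated set. It is a description of a
  model: the worlds are the labels, and accessibility, evidence and valuation are read off from
  the atoms in the antecedents. The rules that add atoms to given atoms, or to none,
  mirror the conditions on Fitting models, so saturation makes this a model
  (\<open>fitting_countermodel\<close>), and induction on formulas shows that it satisfies what stands on the
  left and refutes what stands on the right (\<open>truth\<close>).

  The rules for the Boolean connectives and \<open>RJust\<close> delete their principal formula, so the
  sequents on a branch do not grow towards a limit. The construction therefore carries the set
  of everything seen so far; what keeps it consistent is some underivable sequent inside this
  set such that every formula of the set outside the sequent has already received its
  decomposition (\<open>open_branch\<close>). Such sets can be
  extended to meet any single requirement of saturation (\<open>open_branch_step\<close>). Atoms, and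
  formulas \<open>t:A\<close> on the left, are never deleted, hence a clash of atoms in the set would be a
  clash in the underivable sequent, which would then be initial (\<open>open_branch_no_clash\<close>).

  Fairness by enumeration needs countably many requirements, while the rules for \<open>+\<close> add
  evidence for sums with every term of a language of any cardinality. Since the sequent and
  the constant specification are finite, only finitely many symbols occur in them. Coding these
  by natural numbers yields a sequent in a countable language. Models of the coded
  language pull back along the coding (\<open>fitting_pull\<close>), so validity carries over to the coded
  sequent, and a derivation of it is decoded symbol by symbol (\<open>G3_map\<close>).
\<close>

section \<open>Fair saturation\<close>

text \<open>
  A requirement \<open>(Q, Bs)\<close> asks that a set that includes \<open>Q\<close> includes some branch \<open>B \<in> Bs\<close>.
  Every requirement is visited infinitely often, and a finite \<open>Q\<close> inside the union is already
  inside some stage, so it is still to be visited after its \<open>Q\<close> has appeared.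
\<close>

lemma fair_saturation:
  fixes R :: "('a set \<times> 'a set set) set"
  assumes R: "countable R"
    and Z0: "C Z0"
    and step: "\<And>Z Q Bs. C Z \<Longrightarrow> (Q, Bs) \<in> R \<Longrightarrow> Q \<subseteq> Z \<Longrightarrow> \<exists>B\<in>Bs. C (Z \<union> B)"
    and fin: "\<And>Q Bs. (Q, Bs) \<in> R \<Longrightarrow> finite Q"
  shows "\<exists>Zs :: nat \<Rightarrow> 'a set. Zs 0 = Z0 \<and> mono Zs \<and> (\<forall>n. C (Zs n)) \<and>
    (\<forall>(Q, Bs)\<in>R. Q \<subseteq> (\<Union>n. Zs n) \<longrightarrow> (\<exists>B\<in>Bs. B \<subseteq> (\<Union>n. Zs n)))"
proof (cases "R = {}")
  case True
  then show ?thesis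
    using Z0 by (intro exI[of _ "\<lambda>_. Z0"]) (simp add: mono_def)
next
  case False
  \<comment> \<open>The second component of the code is ignored, so each requirement has arbitrarily late visits.\<close>
  define req where "req n = from_nat_into R (fst (prod_decode n))" for n
  have req_in: "req n \<in> R" for n
    unfolding req_def using False by (rule from_nat_into)
  have req_late: "\<exists>m\<ge>k. req m = r" if "r \<in> R" for r k
  proof (intro exI conjI)
    show "k \<le> prod_encode (to_nat_on R r, k)" by (rule le_prod_encode_2)
    show "req (prod_encode (to_nat_on R r, k)) = r"
      using that R by (simp add: req_def)
  qed
  define good where "good n Z Z' \<longleftrightarrow> C Z' \<and> Z \<subseteq> Z' \<and>
      (fst (req n) \<subseteq> Z \<longrightarrow> (\<exists>B\<in>snd (req n). B \<subseteq> Z'))" for n Z Z'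
  have ex: "\<exists>Z'. good n Z Z'" if "C Z" for n Z
  proof (cases "fst (req n) \<subseteq> Z")
    case True
    have "(fst (req n), snd (req n)) \<in> R" using req_in by simp
    from step[OF that this True] show ?thesis
      unfolding good_def by blast
  next
    case False
    then show ?thesis using that unfolding good_def by blast
  qed
  define Zs where "Zs = rec_nat Z0 (\<lambda>n Z. SOME Z'. good n Z Z')"
  have Zs0: "Zs 0 = Z0" and ZsS: "Zs (Suc n) = (SOME Z'. good n (Zs n) Z')" for n
    by (simp_all add: Zs_def)
  have C: "C (Zs n)" for n
  proof (induction n)
    case (Suc n)
    from someI_ex[OF ex[OF this]] show ?case
      unfolding ZsS good_def by blast
  qed (simp add: Zs0 Z0)
  have good: "good n (Zs n) (Zs (Suc n))" for n
    unfolding ZsS by (rule someI_ex[OF ex[OF C]])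
  have inc: "mono Zs"
    by (rule mono_iff_le_Suc[THEN iffD2, rule_format]) (use good in \<open>auto simp: good_def\<close>)
  have "\<exists>B\<in>Bs. B \<subseteq> (\<Union>n. Zs n)" if r: "(Q, Bs) \<in> R" and Q: "Q \<subseteq> (\<Union>n. Zs n)" for Q Bs
  proof -
    have "\<exists>k. Q \<subseteq> Zs k"
      using fin[OF r] Q
    proof (induction Q rule: finite_induct)
      case (insert x Q)
      then obtain k l where "Q \<subseteq> Zs k" "x \<in> Zs l" by blast
      moreover have "Zs k \<subseteq> Zs (max k l)" "Zs l \<subseteq> Zs (max k l)"
        by (rule monoD[OF inc]; simp)+
      ultimately have "insert x Q \<subseteq> Zs (max k l)" by blast
      then show ?case ..
    qed simp
    then obtain k where k: "Q \<subseteq> Zs k" ..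
    obtain m where m: "m \<ge> k" "req m = (Q, Bs)" using req_late[OF r] by blast
    have "Q \<subseteq> Zs m" using k monoD[OF inc m(1)] by blast
    then obtain B where "B \<in> Bs" "B \<subseteq> Zs (Suc m)"
      using good[of m] m(2) by (auto simp: good_def)
    then show ?thesis by blast
  qed
  then show ?thesis
    using Zs0 inc C by (intro exI[of _ Zs] conjI) auto
qed

section \<open>Saturation steps of the calculus\<close>

lemma Tm_simps [simp]:
  "JVar x \<in> Tm L" "JConst c \<in> Tm L"
  "App s t \<in> Tm L \<longleftrightarrow> s \<in> Tm L \<and> t \<in> Tm L"
  "Plus s t \<in> Tm L \<longleftrightarrow> s \<in> Tm L \<and> t \<in> Tm L"
  "Bang t \<in> Tm L \<longleftrightarrow> has_j4 L \<and> t \<in> Tm L"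
  by (auto intro: Tm.intros elim: Tm.cases)

lemma Fm_simps [simp]:
  "PVar P \<in> Fm L" "Bot \<in> Fm L"
  "Neg A \<in> Fm L \<longleftrightarrow> A \<in> Fm L"
  "Con A B \<in> Fm L \<longleftrightarrow> A \<in> Fm L \<and> B \<in> Fm L"
  "Dis A B \<in> Fm L \<longleftrightarrow> A \<in> Fm L \<and> B \<in> Fm L"
  "Imp A B \<in> Fm L \<longleftrightarrow> A \<in> Fm L \<and> B \<in> Fm L"
  "Just t A \<in> Fm L \<longleftrightarrow> t \<in> Tm L \<and> A \<in> Fm L"
  by (auto intro: Fm.intros elim: Fm.cases)

text \<open>
  The rules that only add one formula to the antecedent and introduce no new label: from the
  list of principal formulas to the added formula. In \<open>Trans\<close>, \<open>w \<noteq> v\<close> keeps the two principal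
  atoms distinct, so that containing them as a set means containing them as a multiset
  without contraction. If \<open>w = v\<close>, the added atom is the second principal one.
\<close>

inductive adds ::
    "logic \<Rightarrow> ('x, 'c, 'p) fm set \<Rightarrow> ('x, 'c, 'p) lfm list \<Rightarrow> ('x, 'c, 'p) lfm \<Rightarrow> bool"
  for L CS where
  LJust: "adds L CS [Lab w (Just t A), Rel w v] (Lab v A)"
| E: "adds L CS [Lab w (Just t A)] (Ev w t A)"
| ElPlus: "s \<in> Tm L \<Longrightarrow> adds L CS [Ev w t A] (Ev w (Plus s t) A)"
| ErPlus: "s \<in> Tm L \<Longrightarrow> adds L CS [Ev w t A] (Ev w (Plus t s) A)"
| EApp: "adds L CS [Ev w s (Imp A B), Ev w t A] (Ev w (App s t) B)"
| AN: "Just (JConst c) F \<in> CS \<Longrightarrow> adds L CS [] (Ev w (JConst c) F)"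
| Ref: "has_jT L \<Longrightarrow> adds L CS [] (Rel w w)"
| EBang: "has_j4 L \<Longrightarrow> adds L CS [Ev w t A] (Ev w (Bang t) (Just t A))"
| Mon: "has_j4 L \<Longrightarrow> adds L CS [Ev w t A, Rel w v] (Ev v t A)"
| Trans: "has_j4 L \<Longrightarrow> w \<noteq> v \<Longrightarrow> adds L CS [Rel w v, Rel v u] (Rel w u)"

text \<open>
  Signed labeled formulas: \<open>Inl\<close> marks the left and \<open>Inr\<close> the right side of the sequent arrow.
\<close>

type_synonym ('x, 'c, 'p) sfm = "('x, 'c, 'p) lfm + ('x, 'c, 'p) lfm"

text \<open>
  The premises of the rule that consumes a given formula, each reduced to the formulas that it
  introduces. There is one premise per member, except for \<open>Just\<close> on the right, where the members
  are the possible choices of the eigenlabel. A formula without members is never consumed.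
\<close>

fun expansions :: "('x, 'c, 'p) sfm \<Rightarrow> ('x, 'c, 'p) sfm set set" where
  "expansions (Inl (Lab w (Neg A))) = {{Inr (Lab w A)}}"
| "expansions (Inr (Lab w (Neg A))) = {{Inl (Lab w A)}}"
| "expansions (Inl (Lab w (Con A B))) = {{Inl (Lab w A), Inl (Lab w B)}}"
| "expansions (Inr (Lab w (Con A B))) = {{Inr (Lab w A)}, {Inr (Lab w B)}}"
| "expansions (Inl (Lab w (Dis A B))) = {{Inl (Lab w A)}, {Inl (Lab w B)}}"
| "expansions (Inr (Lab w (Dis A B))) = {{Inr (Lab w A), Inr (Lab w B)}}"
| "expansions (Inl (Lab w (Imp A B))) = {{Inr (Lab w A)}, {Inl (Lab w B)}}"
| "expansions (Inr (Lab w (Imp A B))) = {{Inl (Lab w A), Inr (Lab w B)}}"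
| "expansions (Inr (Lab w (Just t A))) = range (\<lambda>v. {Inl (Rel w v), Inr (Lab v A)})"
| "expansions _ = {}"

text \<open>
  What must be present for the consuming rule to apply: \<open>RJust\<close> also looks at an evidence atom.
\<close>

fun trigger :: "('x, 'c, 'p) sfm \<Rightarrow> ('x, 'c, 'p) sfm set" where
  "trigger (Inr (Lab w (Just t A))) = {Inr (Lab w (Just t A)), Inl (Ev w t A)}"
| "trigger z = {z}"

text \<open>
  A serial successor is required of every label, including labels that do not occur in the
  sequent, because all labels will be worlds.
\<close>

definition requirements ::
    "logic \<Rightarrow> ('x, 'c, 'p) fm set \<Rightarrow>
     (('x, 'c, 'p) sfm set \<times> ('x, 'c, 'p) sfm set set) set" where
  "requirements L CS =
    (\<lambda>z. (trigger z, expansions z)) ` {z. expansions z \<noteq> {}} \<union>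
    (\<lambda>(P, \<chi>). (Inl ` set P, {{Inl \<chi>}})) ` {(P, \<chi>). adds L CS P \<chi>} \<union>
    (if has_jD L then range (\<lambda>w. ({}, range (\<lambda>v. {Inl (Rel w v)}))) else {})"

definition signed ::
    "('x, 'c, 'p) lfm multiset \<Rightarrow> ('x, 'c, 'p) lfm multiset \<Rightarrow> ('x, 'c, 'p) sfm set" where
  "signed \<Gamma> \<Delta> = Inl ` set_mset \<Gamma> \<union> Inr ` set_mset \<Delta>"

text \<open>
  \<open>Z\<close> records all formulas met on a path through underivable sequents that has reached
  \<open>\<Gamma> \<Rightarrow> \<Delta>\<close>: what is no longer in this sequent was consumed, and its expansion is in \<open>Z\<close>.
\<close>

definition open_branch ::
    "logic \<Rightarrow> ('x, 'c, 'p) fm set \<Rightarrow> ('x, 'c, 'p) sfm set \<Rightarrow> bool" where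
  "open_branch L CS Z \<longleftrightarrow> (\<exists>\<Gamma> \<Delta>. sequent L \<Gamma> \<Delta> \<and> \<not> G3 L CS \<Gamma> \<Delta> \<and> signed \<Gamma> \<Delta> \<subseteq> Z \<and>
     (\<forall>z \<in> Z - signed \<Gamma> \<Delta>. \<exists>B\<in>expansions z. B \<subseteq> Z))"

lemma in_signed [simp]:
  "Inl \<phi> \<in> signed \<Gamma> \<Delta> \<longleftrightarrow> \<phi> \<in># \<Gamma>" "Inr \<phi> \<in> signed \<Gamma> \<Delta> \<longleftrightarrow> \<phi> \<in># \<Delta>"
  by (auto simp: signed_def)

lemma signed_add [simp]:
  "signed (add_mset \<phi> \<Gamma>) \<Delta> = insert (Inl \<phi>) (signed \<Gamma> \<Delta>)"
  "signed \<Gamma> (add_mset \<phi> \<Delta>) = insert (Inr \<phi>) (signed \<Gamma> \<Delta>)"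
  by (auto simp: signed_def)

lemma sequent_add [simp]:
  "sequent L (add_mset \<phi> \<Gamma>) \<Delta> \<longleftrightarrow> lfm_in L \<phi> \<and> sequent L \<Gamma> \<Delta>"
  "sequent L \<Gamma> (add_mset \<phi> \<Delta>) \<longleftrightarrow> lfm_in L \<phi> \<and> sequent L \<Gamma> \<Delta>"
  by (auto simp: sequent_def)

lemma ex_fresh:
  fixes \<Gamma> :: "('x, 'c, 'p) lfm multiset"
  shows "\<exists>v. fresh v \<Gamma> \<Delta>"
proof -
  have "finite (labels \<phi>)" for \<phi> :: "('x, 'c, 'p) lfm" by (cases \<phi>) auto
  then have "finite (\<Union>\<phi>\<in>set_mset (\<Gamma> + \<Delta>). labels \<phi>)" by simp
  from ex_new_if_finite[OF infinite_UNIV_nat this] show ?thesis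
    by (auto simp: fresh_def)
qed

text \<open>
  Contraposition of the logical rules. The principal formula \<open>z\<close> may be lost on the way to the
  premise, nothing else is.
\<close>

lemma consuming_step:
  assumes seq: "sequent L \<Gamma> \<Delta>" and nd: "\<not> G3 L CS \<Gamma> \<Delta>"
    and z: "trigger z \<subseteq> signed \<Gamma> \<Delta>" and ne: "expansions z \<noteq> {}"
  shows "\<exists>B\<in>expansions z. \<exists>\<Gamma>' \<Delta>'. sequent L \<Gamma>' \<Delta>' \<and> \<not> G3 L CS \<Gamma>' \<Delta>' \<and> B \<subseteq> signed \<Gamma>' \<Delta>' \<and>
    signed \<Gamma> \<Delta> - {z} \<subseteq> signed \<Gamma>' \<Delta>' \<and> signed \<Gamma>' \<Delta>' \<subseteq> signed \<Gamma> \<Delta> \<union> B"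
proof (cases z rule: expansions.cases)
  case (1 w A)
  with z obtain \<Gamma>0 where \<Gamma>: "\<Gamma> = add_mset (Lab w (Neg A)) \<Gamma>0"
    by (auto dest: multi_member_split)
  have "\<not> G3 L CS \<Gamma>0 (add_mset (Lab w A) \<Delta>)"
    using nd unfolding \<Gamma> by (rule contrapos_nn) (rule G3.LNeg)
  with 1 seq show ?thesis
    by (intro bexI[of _ "{Inr (Lab w A)}"] exI[of _ \<Gamma>0] exI[of _ "add_mset (Lab w A) \<Delta>"])
      (auto simp: \<Gamma>)
next
  case (2 w A)
  with z obtain \<Delta>0 where \<Delta>: "\<Delta> = add_mset (Lab w (Neg A)) \<Delta>0"
    by (auto dest: multi_member_split)
  have "\<not> G3 L CS (add_mset (Lab w A) \<Gamma>) \<Delta>0"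
    using nd unfolding \<Delta> by (rule contrapos_nn) (rule G3.RNeg)
  with 2 seq show ?thesis
    by (intro bexI[of _ "{Inl (Lab w A)}"] exI[of _ "add_mset (Lab w A) \<Gamma>"] exI[of _ \<Delta>0])
      (auto simp: \<Delta>)
next
  case (3 w A B)
  with z obtain \<Gamma>0 where \<Gamma>: "\<Gamma> = add_mset (Lab w (Con A B)) \<Gamma>0"
    by (auto dest: multi_member_split)
  have "\<not> G3 L CS (add_mset (Lab w A) (add_mset (Lab w B) \<Gamma>0)) \<Delta>"
    using nd unfolding \<Gamma> by (rule contrapos_nn) (rule G3.LCon)
  with 3 seq show ?thesis
    by (intro bexI[of _ "{Inl (Lab w A), Inl (Lab w B)}"]
        exI[of _ "add_mset (Lab w A) (add_mset (Lab w B) \<Gamma>0)"] exI[of _ \<Delta>]) (auto simp: \<Gamma>)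
next
  case (4 w A B)
  with z obtain \<Delta>0 where \<Delta>: "\<Delta> = add_mset (Lab w (Con A B)) \<Delta>0"
    by (auto dest: multi_member_split)
  obtain D where "D = A \<or> D = B" and "\<not> G3 L CS \<Gamma> (add_mset (Lab w D) \<Delta>0)"
    using nd G3.RCon[of L CS \<Gamma> w A \<Delta>0 B] unfolding \<Delta> by blast
  with 4 seq show ?thesis
    by (intro bexI[of _ "{Inr (Lab w D)}"] exI[of _ \<Gamma>] exI[of _ "add_mset (Lab w D) \<Delta>0"])
      (auto simp: \<Delta>)
next
  case (5 w A B)
  with z obtain \<Gamma>0 where \<Gamma>: "\<Gamma> = add_mset (Lab w (Dis A B)) \<Gamma>0"
    by (auto dest: multi_member_split)
  obtain D where "D = A \<or> D = B" and "\<not> G3 L CS (add_mset (Lab w D) \<Gamma>0) \<Delta>"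
    using nd G3.LDis[of L CS w A \<Gamma>0 \<Delta> B] unfolding \<Gamma> by blast
  with 5 seq show ?thesis
    by (intro bexI[of _ "{Inl (Lab w D)}"] exI[of _ "add_mset (Lab w D) \<Gamma>0"] exI[of _ \<Delta>])
      (auto simp: \<Gamma>)
next
  case (6 w A B)
  with z obtain \<Delta>0 where \<Delta>: "\<Delta> = add_mset (Lab w (Dis A B)) \<Delta>0"
    by (auto dest: multi_member_split)
  have "\<not> G3 L CS \<Gamma> (add_mset (Lab w A) (add_mset (Lab w B) \<Delta>0))"
    using nd unfolding \<Delta> by (rule contrapos_nn) (rule G3.RDis)
  with 6 seq show ?thesis
    by (intro bexI[of _ "{Inr (Lab w A), Inr (Lab w B)}"] exI[of _ \<Gamma>]
        exI[of _ "add_mset (Lab w A) (add_mset (Lab w B) \<Delta>0)"]) (auto simp: \<Delta>)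
next
  case (7 w A B)
  with z obtain \<Gamma>0 where \<Gamma>: "\<Gamma> = add_mset (Lab w (Imp A B)) \<Gamma>0"
    by (auto dest: multi_member_split)
  consider "\<not> G3 L CS \<Gamma>0 (add_mset (Lab w A) \<Delta>)" | "\<not> G3 L CS (add_mset (Lab w B) \<Gamma>0) \<Delta>"
    using nd G3.LImp[of L CS \<Gamma>0 w A \<Delta> B] unfolding \<Gamma> by blast
  then show ?thesis
  proof cases
    case 1
    with 7 seq show ?thesis
      by (intro bexI[of _ "{Inr (Lab w A)}"] exI[of _ \<Gamma>0] exI[of _ "add_mset (Lab w A) \<Delta>"])
        (auto simp: \<Gamma>)
  next
    case 2
    with 7 seq show ?thesis
      by (intro bexI[of _ "{Inl (Lab w B)}"] exI[of _ "add_mset (Lab w B) \<Gamma>0"] exI[of _ \<Delta>])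
        (auto simp: \<Gamma>)
  qed
next
  case (8 w A B)
  with z obtain \<Delta>0 where \<Delta>: "\<Delta> = add_mset (Lab w (Imp A B)) \<Delta>0"
    by (auto dest: multi_member_split)
  have "\<not> G3 L CS (add_mset (Lab w A) \<Gamma>) (add_mset (Lab w B) \<Delta>0)"
    using nd unfolding \<Delta> by (rule contrapos_nn) (rule G3.RImp)
  with 8 seq show ?thesis
    by (intro bexI[of _ "{Inl (Lab w A), Inr (Lab w B)}"] exI[of _ "add_mset (Lab w A) \<Gamma>"]
        exI[of _ "add_mset (Lab w B) \<Delta>0"]) (auto simp: \<Delta>)
next
  case (9 w t A)
  with z obtain \<Gamma>0 \<Delta>0 where \<Gamma>: "\<Gamma> = add_mset (Ev w t A) \<Gamma>0"
      and \<Delta>: "\<Delta> = add_mset (Lab w (Just t A)) \<Delta>0"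
    by (auto dest!: multi_member_split)
  obtain v where "fresh v \<Gamma> \<Delta>" using ex_fresh by blast
  then have "\<not> G3 L CS (add_mset (Rel w v) \<Gamma>) (add_mset (Lab v A) \<Delta>0)"
    using nd G3.RJust[of L CS w v t A \<Gamma>0 \<Delta>0] unfolding \<Gamma> \<Delta> by blast
  with 9 seq show ?thesis
    by (intro bexI[of _ "{Inl (Rel w v), Inr (Lab v A)}"] exI[of _ "add_mset (Rel w v) \<Gamma>"]
        exI[of _ "add_mset (Lab v A) \<Delta>0"]) (auto simp: \<Delta>)
qed (use ne in simp_all)

lemma adds_admissible:
  assumes "adds L CS P \<chi>" and "set P \<subseteq> set_mset \<Gamma>" and "G3 L CS (add_mset \<chi> \<Gamma>) \<Delta>"
  shows "G3 L CS \<Gamma> \<Delta>"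
proof -
  have "distinct P" using assms(1) by cases auto
  then have "mset P \<subseteq># \<Gamma>"
    using assms(2) by (auto simp: distinct_count_atmost_1 subseteq_mset_def Suc_le_eq)
  then obtain \<Gamma>0 where \<Gamma>: "\<Gamma> = mset P + \<Gamma>0" by (auto simp: mset_subset_eq_exists_conv)
  show ?thesis
    using assms(1)
  proof cases
    case LJust
    with assms(3) \<Gamma> show ?thesis by simp (rule G3.LJust, assumption+)
  next
    case E
    with assms(3) \<Gamma> show ?thesis by simp (rule G3.E, assumption+)
  next
    case ElPlus
    with assms(3) \<Gamma> show ?thesis by simp (rule G3.ElPlus, assumption+)
  next
    case ErPlus
    with assms(3) \<Gamma> show ?thesis by simp (rule G3.ErPlus, assumption+)
  next
    case EApp
    with assms(3) \<Gamma> show ?thesis by simp (rule G3.EApp, assumption+)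
  next
    case (AN c F w)
    then show ?thesis using assms(3) by - (rule G3.AN[OF AN(3)], simp)
  next
    case (Ref w)
    then show ?thesis using assms(3) by - (rule G3.Ref[OF Ref(3)], simp)
  next
    case EBang
    with assms(3) \<Gamma> show ?thesis by simp (rule G3.EBang, assumption+)
  next
    case Mon
    with assms(3) \<Gamma> show ?thesis by simp (rule G3.Mon, assumption+)
  next
    case Trans
    with assms(3) \<Gamma> show ?thesis by simp (rule G3.Trans, assumption+)
  qed
qed

lemma adds_lfm_in:
  assumes "adds L CS P \<chi>" and "\<forall>\<phi>\<in>set P. lfm_in L \<phi>"
    and "\<And>c F. Just (JConst c) F \<in> CS \<Longrightarrow> F \<in> Fm L"
  shows "lfm_in L \<chi>"
  using assms by cases auto

lemma adds_not_consumed: "adds L CS P \<chi> \<Longrightarrow> \<phi> \<in> set P \<Longrightarrow> expansions (Inl \<phi>) = {}"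
  by (cases rule: adds.cases) auto

text \<open>
  If a formula that is to be expanded has left the current sequent, its expansion is already
  present. Otherwise the corresponding rule applies to the sequent. The principal formulas of the
  additive rules and the evidence atom of \<open>RJust\<close> cannot have left the sequent, because no rule
  consumes them.
\<close>

lemma open_branch_step:
  assumes CS: "\<And>c F. Just (JConst c) F \<in> CS \<Longrightarrow> F \<in> Fm L"
    and Z: "open_branch L CS Z" and r: "(Q, Bs) \<in> requirements L CS" and Q: "Q \<subseteq> Z"
  shows "\<exists>B\<in>Bs. open_branch L CS (Z \<union> B)"
proof -
  obtain \<Gamma> \<Delta> where seq: "sequent L \<Gamma> \<Delta>" and nd: "\<not> G3 L CS \<Gamma> \<Delta>" and sub: "signed \<Gamma> \<Delta> \<subseteq> Z"
    and discharged: "\<And>z. z \<in> Z \<Longrightarrow> z \<notin> signed \<Gamma> \<Delta> \<Longrightarrow> \<exists>B\<in>expansions z. B \<subseteq> Z"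
    using Z unfolding open_branch_def by blast
  have left_grows: "open_branch L CS (Z \<union> {Inl \<chi>})"
    if "lfm_in L \<chi>" "\<not> G3 L CS (add_mset \<chi> \<Gamma>) \<Delta>" for \<chi>
    unfolding open_branch_def
  proof (intro exI conjI ballI)
    show "sequent L (add_mset \<chi> \<Gamma>) \<Delta>" using that(1) seq by simp
    show "signed (add_mset \<chi> \<Gamma>) \<Delta> \<subseteq> Z \<union> {Inl \<chi>}" using sub by auto
    fix u assume "u \<in> Z \<union> {Inl \<chi>} - signed (add_mset \<chi> \<Gamma>) \<Delta>"
    then have "u \<in> Z" "u \<notin> signed \<Gamma> \<Delta>" by auto
    from discharged[OF this] show "\<exists>B\<in>expansions u. B \<subseteq> Z \<union> {Inl \<chi>}" by blast
  qed (fact that(2))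
  consider (expansions) z where "Q = trigger z" "Bs = expansions z" "expansions z \<noteq> {}"
    | (adds) P \<chi> where "Q = Inl ` set P" "Bs = {{Inl \<chi>}}" "adds L CS P \<chi>"
    | (ser) w where "has_jD L" "Bs = range (\<lambda>v. {Inl (Rel w v)})"
    using r unfolding requirements_def by (auto split: if_split_asm)
  then show ?thesis
  proof cases
    case (expansions z)
    have "z \<in> trigger z" and ev: "trigger z \<subseteq> {z} \<union> {u. expansions u = {}}"
      by (cases z rule: trigger.cases; simp)+
    then have zZ: "z \<in> Z" using Q expansions(1) by blast
    show ?thesis
    proof (cases "z \<in> signed \<Gamma> \<Delta>")
      case False
      then obtain B where "B \<in> expansions z" "B \<subseteq> Z" using discharged zZ by blast
      then show ?thesis using Z expansions(2) by (metis sup.absorb1)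
    next
      case True
      have "trigger z \<subseteq> signed \<Gamma> \<Delta>"
      proof
        fix u assume "u \<in> trigger z"
        then have "u = z \<or> u \<in> Z \<and> expansions u = {}" using Q expansions(1) ev by blast
        then show "u \<in> signed \<Gamma> \<Delta>" using True discharged by auto
      qed
      from consuming_step[OF seq nd this expansions(3)] obtain B \<Gamma>' \<Delta>' where B: "B \<in> expansions z"
        and *: "sequent L \<Gamma>' \<Delta>'" "\<not> G3 L CS \<Gamma>' \<Delta>'" "B \<subseteq> signed \<Gamma>' \<Delta>'"
          "signed \<Gamma> \<Delta> - {z} \<subseteq> signed \<Gamma>' \<Delta>'" "signed \<Gamma>' \<Delta>' \<subseteq> signed \<Gamma> \<Delta> \<union> B"
        by blast
      have "\<exists>B'\<in>expansions u. B' \<subseteq> Z \<union> B" if "u \<in> Z \<union> B" "u \<notin> signed \<Gamma>' \<Delta>'" for u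
      proof (cases "u = z")
        case True
        then show ?thesis using B by blast
      next
        case False
        then have "u \<in> Z" "u \<notin> signed \<Gamma> \<Delta>" using that * by auto
        from discharged[OF this] show ?thesis by blast
      qed
      moreover have "signed \<Gamma>' \<Delta>' \<subseteq> Z \<union> B" using *(5) sub by blast
      ultimately have "open_branch L CS (Z \<union> B)"
        unfolding open_branch_def using *(1,2) by blast
      then show ?thesis using B expansions(2) by blast
    qed
  next
    case (adds P \<chi>)
    have P: "set P \<subseteq> set_mset \<Gamma>"
    proof
      fix \<phi> assume \<phi>: "\<phi> \<in> set P"
      have "Inl \<phi> \<in> Z" using \<phi> Q adds(1) by blast
      moreover have "expansions (Inl \<phi>) = {}" using adds_not_consumed[OF adds(3) \<phi>] .
      ultimately show "\<phi> \<in># \<Gamma>" using discharged[of "Inl \<phi>"] by auto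
    qed
    have "\<forall>\<phi>\<in>set P. lfm_in L \<phi>" using P seq by (auto simp: sequent_def)
    then have "lfm_in L \<chi>" using adds_lfm_in[OF adds(3)] CS by blast
    moreover have "\<not> G3 L CS (add_mset \<chi> \<Gamma>) \<Delta>"
      using adds_admissible[OF adds(3) P] nd by blast
    ultimately show ?thesis using left_grows adds(2) by blast
  next
    case (ser w)
    obtain v where "fresh v \<Gamma> \<Delta>" using ex_fresh by blast
    then have "\<not> G3 L CS (add_mset (Rel w v) \<Gamma>) \<Delta>" using G3.Ser[OF ser(1)] nd by blast
    then have "open_branch L CS (Z \<union> {Inl (Rel w v)})" by (intro left_grows) simp_all
    then show ?thesis using ser(2) by blast
  qed
qed

lemma open_branch_no_clash:
  assumes "open_branch L CS Z"
  shows "Inl (Lab w Bot) \<notin> Z"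
    and "Inl (Lab w (PVar P)) \<in> Z \<Longrightarrow> Inr (Lab w (PVar P)) \<notin> Z"
    and "Inl (Rel w v) \<in> Z \<Longrightarrow> Inr (Rel w v) \<notin> Z"
    and "Inl (Ev w t A) \<in> Z \<Longrightarrow> Inr (Ev w t A) \<notin> Z"
proof -
  obtain \<Gamma> \<Delta> where seq: "sequent L \<Gamma> \<Delta>" and nd: "\<not> G3 L CS \<Gamma> \<Delta>"
    and discharged: "\<And>z. z \<in> Z \<Longrightarrow> expansions z = {} \<Longrightarrow> z \<in> signed \<Gamma> \<Delta>"
    using assms unfolding open_branch_def by blast
  have bot: "\<not> (Lab w Bot) \<in># \<Gamma>"
    using nd seq G3.InitBot by (metis multi_member_split)
  have p: "\<not> (Lab w (PVar P) \<in># \<Gamma> \<and> Lab w (PVar P) \<in># \<Delta>)"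
    using nd seq G3.InitP by (metis multi_member_split)
  have rel: "\<not> (Rel w v \<in># \<Gamma> \<and> Rel w v \<in># \<Delta>)"
    using nd seq G3.InitR by (metis multi_member_split)
  have ev: "\<not> (Ev w t A \<in># \<Gamma> \<and> Ev w t A \<in># \<Delta>)"
    using nd seq G3.InitE by (metis multi_member_split)
  show "Inl (Lab w Bot) \<notin> Z" using discharged[of "Inl (Lab w Bot)"] bot by auto
  show "Inl (Lab w (PVar P)) \<in> Z \<Longrightarrow> Inr (Lab w (PVar P)) \<notin> Z"
    using discharged[of "Inl (Lab w (PVar P))"] discharged[of "Inr (Lab w (PVar P))"] p by auto
  show "Inl (Rel w v) \<in> Z \<Longrightarrow> Inr (Rel w v) \<notin> Z"
    using discharged[of "Inl (Rel w v)"] discharged[of "Inr (Rel w v)"] rel by auto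
  show "Inl (Ev w t A) \<in> Z \<Longrightarrow> Inr (Ev w t A) \<notin> Z"
    using discharged[of "Inl (Ev w t A)"] discharged[of "Inr (Ev w t A)"] ev by auto
qed

section \<open>The countermodel of a saturated set\<close>

locale saturated =
  fixes L :: logic and CS :: "('x, 'c, 'p) fm set"
    and Z :: "('x, 'c, 'p) sfm set"
  assumes met: "(Q, Bs) \<in> requirements L CS \<Longrightarrow> Q \<subseteq> Z \<Longrightarrow> \<exists>B\<in>Bs. B \<subseteq> Z"
    and no_Bot: "Inl (Lab w Bot) \<notin> Z"
    and no_PVar: "Inl (Lab w (PVar P)) \<in> Z \<Longrightarrow> Inr (Lab w (PVar P)) \<notin> Z"
    and no_Rel: "Inl (Rel w v) \<in> Z \<Longrightarrow> Inr (Rel w v) \<notin> Z"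
    and no_Ev: "Inl (Ev w t A) \<in> Z \<Longrightarrow> Inr (Ev w t A) \<notin> Z"
begin

lemma met_expansions: "trigger z \<subseteq> Z \<Longrightarrow> expansions z \<noteq> {} \<Longrightarrow> \<exists>B\<in>expansions z. B \<subseteq> Z"
  by (rule met) (auto simp: requirements_def)

lemma met_adds:
  assumes "adds L CS P \<chi>" and "Inl ` set P \<subseteq> Z"
  shows "Inl \<chi> \<in> Z"
proof -
  have "(Inl ` set P, {{Inl \<chi>}}) \<in> requirements L CS"
    using assms(1) by (force simp: requirements_def)
  from met[OF this assms(2)] show ?thesis by simp
qed

lemma met_ser: "has_jD L \<Longrightarrow> \<exists>v. Inl (Rel w v) \<in> Z"
  using met[of "{}" "range (\<lambda>v. {Inl (Rel w v)})"] by (auto simp: requirements_def)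

text \<open>
  The countermodel lives on the image of an injection \<open>e\<close> of the labels into the given type of
  worlds, and \<open>e\<close> itself is the interpretation that refutes the sequent.
\<close>

definition countermodel :: "(label \<Rightarrow> 'w) \<Rightarrow> ('w, 'x, 'c, 'p) model" where
  "countermodel e = \<lparr>worlds = range e, acc = {(e w, e v) |w v. Inl (Rel w v) \<in> Z},
     evid = \<lambda>t A. e ` {w. Inl (Ev w t A) \<in> Z}, val = \<lambda>P. e ` {w. Inl (Lab w (PVar P)) \<in> Z}\<rparr>"

lemma countermodel_sel [simp]:
  "worlds (countermodel e) = range e"
  "inj e \<Longrightarrow> (e w, e v) \<in> acc (countermodel e) \<longleftrightarrow> Inl (Rel w v) \<in> Z"
  "inj e \<Longrightarrow> e w \<in> evid (countermodel e) t A \<longleftrightarrow> Inl (Ev w t A) \<in> Z"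
  "inj e \<Longrightarrow> e w \<in> val (countermodel e) P \<longleftrightarrow> Inl (Lab w (PVar P)) \<in> Z"
  by (auto simp: countermodel_def dest: injD)

lemma acc_countermodelE:
  assumes "(x, y) \<in> acc (countermodel e)"
  obtains w v where "x = e w" "y = e v" "Inl (Rel w v) \<in> Z"
  using assms by (auto simp: countermodel_def)

lemma evid_countermodelE:
  assumes "x \<in> evid (countermodel e) t A"
  obtains w where "x = e w" "Inl (Ev w t A) \<in> Z"
  using assms by (auto simp: countermodel_def)

lemma fitting_countermodel:
  assumes e: "inj e"
  shows "fitting_model L CS (countermodel e)"
proof -
  let ?M = "countermodel e"
  have 0: "range e \<noteq> {}" by simp
  have 1: "acc ?M \<subseteq> range e \<times> range e" "\<And>P. val ?M P \<subseteq> range e" "\<And>t A. evid ?M t A \<subseteq> range e"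
    by (auto simp: countermodel_def)
  have 2: "evid ?M (JConst c) F = range e" if "Just (JConst c) F \<in> CS" for c F
    using met_adds[OF adds.AN[OF that]] by (simp add: countermodel_def)
  have 3: "evid ?M s (Imp A B) \<inter> evid ?M t A \<subseteq> evid ?M (App s t) B" for s t A B
    using met_adds[OF adds.EApp, of _ s A B t] e by (auto simp: inj_eq elim!: evid_countermodelE)
  have 4: "evid ?M s A \<union> evid ?M t A \<subseteq> evid ?M (Plus s t) A" if "s \<in> Tm L" "t \<in> Tm L" for s t A
    using met_adds[OF adds.ElPlus[OF that(1)], of _ t A] met_adds[OF adds.ErPlus[OF that(2)], of _ s A] e
    by (auto simp: inj_eq elim!: evid_countermodelE)
  have 5: "(x, x) \<in> acc ?M" if "has_jT L" "x \<in> range e" for x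
    using met_adds[OF adds.Ref[OF that(1)]] that(2) e by auto
  have 6: "\<exists>y\<in>range e. (x, y) \<in> acc ?M" if "has_jD L" "x \<in> range e" for x
    using met_ser[OF that(1)] that(2) e by auto
  have 7: "trans (acc ?M)" if "has_j4 L"
  proof (rule transI)
    fix x y z assume "(x, y) \<in> acc ?M" "(y, z) \<in> acc ?M"
    then obtain w v u where "x = e w" "y = e v" "z = e u" "Inl (Rel w v) \<in> Z" "Inl (Rel v u) \<in> Z"
      by (auto elim!: acc_countermodelE simp: inj_eq[OF e])
    then show "(x, z) \<in> acc ?M"
      using met_adds[OF adds.Trans[OF that], of w v u] e by (cases "w = v") auto
  qed
  have 8: "y \<in> evid ?M t A" if "has_j4 L" "x \<in> evid ?M t A \<and> (x, y) \<in> acc ?M" for t A x y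
    using that(2) met_adds[OF adds.Mon[OF that(1)], of _ t A] e
    by (auto elim!: evid_countermodelE acc_countermodelE simp: inj_eq)
  have 9: "evid ?M t A \<subseteq> evid ?M (Bang t) (Just t A)" if "has_j4 L" for t A
    using met_adds[OF adds.EBang[OF that], of _ t A] e by (auto simp: inj_eq elim!: evid_countermodelE)
  show ?thesis
    unfolding fitting_model_def countermodel_sel(1)
    by (intro conjI ballI allI impI; rule 0 1 2 3 4 5 6 7 8 9; assumption)
qed

text \<open>
  For \<open>t:A\<close> on the right, no witness is available when the evidence atom is missing on the left.
  But then \<open>w\<close> is not in the evidence set of the countermodel, which refutes \<open>t:A\<close> as well.
\<close>

lemma truth:
  assumes e: "inj e"
  shows "(Inl (Lab w A) \<in> Z \<longrightarrow> forces (countermodel e) (e w) A) \<and>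
    (Inr (Lab w A) \<in> Z \<longrightarrow> \<not> forces (countermodel e) (e w) A)"
proof (induction A arbitrary: w)
  case (Just t A)
  have "forces (countermodel e) (e w) (Just t A)" if T: "Inl (Lab w (Just t A)) \<in> Z"
  proof -
    have "Inl (Ev w t A) \<in> Z" using met_adds[OF adds.E, of w t A] T by simp
    moreover have "forces (countermodel e) y A" if y: "(e w, y) \<in> acc (countermodel e)" for y
    proof -
      obtain v where v: "y = e v" "Inl (Rel w v) \<in> Z"
        using y by (auto simp: inj_eq[OF e] elim!: acc_countermodelE)
      then have "Inl (Lab v A) \<in> Z" using met_adds[OF adds.LJust, of w t A v] T by simp
      with Just v(1) show ?thesis by blast
    qed
    ultimately show ?thesis using e by simp
  qed
  moreover have "\<not> forces (countermodel e) (e w) (Just t A)" if F: "Inr (Lab w (Just t A)) \<in> Z"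
  proof (cases "Inl (Ev w t A) \<in> Z")
    case True
    then obtain v where v: "Inl (Rel w v) \<in> Z" "Inr (Lab v A) \<in> Z"
      using met_expansions[of "Inr (Lab w (Just t A))"] F by auto
    then have "(e w, e v) \<in> acc (countermodel e)" "\<not> forces (countermodel e) (e v) A"
      using Just e by auto
    then show ?thesis by auto
  qed (use e in simp)
  ultimately show ?case by blast
next
  case (PVar P)
  then show ?case using e no_PVar by auto
next
  case Bot
  then show ?case using no_Bot by simp
next
  case (Neg A)
  then show ?case
    using met_expansions[of "Inl (Lab w (Neg A))"]
      met_expansions[of "Inr (Lab w (Neg A))"] by auto
next
  case (Con A B)
  then show ?case
    using met_expansions[of "Inl (Lab w (Con A B))"]
      met_expansions[of "Inr (Lab w (Con A B))"] by auto
next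
  case (Dis A B)
  then show ?case
    using met_expansions[of "Inl (Lab w (Dis A B))"]
      met_expansions[of "Inr (Lab w (Dis A B))"] by auto
next
  case (Imp A B)
  then show ?case
    using met_expansions[of "Inl (Lab w (Imp A B))"]
      met_expansions[of "Inr (Lab w (Imp A B))"] by auto
qed

lemma countermodel_refutes:
  assumes e: "inj e" and sub: "signed \<Gamma> \<Delta> \<subseteq> Z"
  shows "\<not> valid_in (countermodel e) \<Gamma> \<Delta>"
proof -
  have "validates (countermodel e) e \<phi>" if "Inl \<phi> \<in> Z" for \<phi>
    using that e truth[OF e] by (cases \<phi>) auto
  moreover have "\<not> validates (countermodel e) e \<phi>" if "Inr \<phi> \<in> Z" for \<phi>
    using that e truth[OF e] no_Rel no_Ev by (cases \<phi>) auto
  moreover have "interpretation_in (countermodel e) e" by (simp add: interpretation_in_def)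
  ultimately show ?thesis using sub by (force simp: valid_in_def signed_def)
qed

end

section \<open>Completeness for countable languages\<close>

instance tm :: (countable, countable) countable by countable_datatype
instance fm :: (countable, countable, countable) countable by countable_datatype
instance lfm :: (countable, countable, countable) countable by countable_datatype

lemma completeness_countable:
  fixes CS :: "('x::countable, 'c::countable, 'p::countable) fm set"
  assumes CS: "\<And>c F. Just (JConst c) F \<in> CS \<Longrightarrow> F \<in> Fm L"
    and seq: "sequent L \<Gamma> \<Delta>"
    and inf: "infinite (UNIV :: 'w set)"
    and valid: "\<And>M :: ('w, 'x, 'c, 'p) model. fitting_model L CS M \<Longrightarrow> valid_in M \<Gamma> \<Delta>"
  shows "G3 L CS \<Gamma> \<Delta>"
proof (rule ccontr)
  assume nd: "\<not> G3 L CS \<Gamma> \<Delta>"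
  have count: "countable (requirements L CS)" by (simp add: requirements_def)
  have start: "open_branch L CS (signed \<Gamma> \<Delta>)" using seq nd by (auto simp: open_branch_def)
  have step: "\<exists>B\<in>Bs. open_branch L CS (Z \<union> B)"
    if "open_branch L CS Z" "(Q, Bs) \<in> requirements L CS" "Q \<subseteq> Z" for Z Q Bs
    using open_branch_step[OF _ that] CS by blast
  have fin: "finite Q" if "(Q, Bs) \<in> requirements L CS" for Q Bs
  proof -
    have "finite (trigger z)" for z :: "('x, 'c, 'p) sfm"
      by (cases z rule: trigger.cases) auto
    with that show ?thesis by (auto simp: requirements_def split: if_splits)
  qed
  have "\<exists>Zs :: nat \<Rightarrow> _. Zs 0 = signed \<Gamma> \<Delta> \<and> mono Zs \<and> (\<forall>n. open_branch L CS (Zs n)) \<and>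
      (\<forall>(Q, Bs)\<in>requirements L CS. Q \<subseteq> (\<Union>n. Zs n) \<longrightarrow> (\<exists>B\<in>Bs. B \<subseteq> (\<Union>n. Zs n)))"
    using count start step fin by (rule fair_saturation)
  then obtain Zs :: "nat \<Rightarrow> _" where Zs0: "Zs 0 = signed \<Gamma> \<Delta>" and inc: "mono Zs"
    and all_open: "\<forall>n. open_branch L CS (Zs n)"
    and met: "\<forall>(Q, Bs)\<in>requirements L CS. Q \<subseteq> (\<Union>n. Zs n) \<longrightarrow>
      (\<exists>B\<in>Bs. B \<subseteq> (\<Union>n. Zs n))"
    by (elim exE conjE)
  note op = all_open[rule_format]
  have common: "\<exists>n. x \<in> Zs n \<and> y \<in> Zs n" if xy: "x \<in> (\<Union>n. Zs n)" "y \<in> (\<Union>n. Zs n)" for x y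
  proof -
    obtain k l where "x \<in> Zs k" "y \<in> Zs l" using xy by blast
    moreover have "Zs k \<subseteq> Zs (max k l)" "Zs l \<subseteq> Zs (max k l)"
      by (rule monoD[OF inc]; simp)+
    ultimately show ?thesis by blast
  qed
  interpret saturated L CS "\<Union>n. Zs n"
  proof
    show "(Q, Bs) \<in> requirements L CS \<Longrightarrow> Q \<subseteq> (\<Union>n. Zs n) \<Longrightarrow> \<exists>B\<in>Bs. B \<subseteq> (\<Union>n. Zs n)" for Q Bs
      using met by fast
  next
    fix w v t P A
    show "Inl (Lab w Bot) \<notin> (\<Union>n. Zs n)"
      using open_branch_no_clash(1)[OF op] by blast
    show "Inl (Lab w (PVar P)) \<in> (\<Union>n. Zs n) \<Longrightarrow> Inr (Lab w (PVar P)) \<notin> (\<Union>n. Zs n)"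
      using common[of "Inl (Lab w (PVar P))" "Inr (Lab w (PVar P))"] open_branch_no_clash(2)[OF op]
      by blast
    show "Inl (Rel w v) \<in> (\<Union>n. Zs n) \<Longrightarrow> Inr (Rel w v) \<notin> (\<Union>n. Zs n)"
      using common[of "Inl (Rel w v)" "Inr (Rel w v)"] open_branch_no_clash(3)[OF op] by blast
    show "Inl (Ev w t A) \<in> (\<Union>n. Zs n) \<Longrightarrow> Inr (Ev w t A) \<notin> (\<Union>n. Zs n)"
      using common[of "Inl (Ev w t A)" "Inr (Ev w t A)"] open_branch_no_clash(4)[OF op] by blast
  qed
  obtain e :: "label \<Rightarrow> 'w" where e: "inj e" using inf infinite_countable_subset by blast
  have "signed \<Gamma> \<Delta> \<subseteq> (\<Union>n. Zs n)" using Zs0 by blast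
  from countermodel_refutes[OF e this] valid[OF fitting_countermodel[OF e]] show False by blast
qed

section \<open>Renaming of variables and constants\<close>

lemma map_tm_in [simp]: "map_tm f g t \<in> Tm L \<longleftrightarrow> t \<in> Tm L"
  by (induction t) auto

lemma map_fm_in [simp]: "map_fm f g h A \<in> Fm L \<longleftrightarrow> A \<in> Fm L"
  by (induction A) auto

lemma lfm_in_map [simp]: "lfm_in L (map_lfm f g h \<phi>) \<longleftrightarrow> lfm_in L \<phi>"
  by (cases \<phi>) auto

lemma sequent_map [simp]:
  "sequent L (image_mset (map_lfm f g h) \<Gamma>) (image_mset (map_lfm f g h) \<Delta>) \<longleftrightarrow> sequent L \<Gamma> \<Delta>"
  by (auto simp: sequent_def ball_Un)

lemma labels_map [simp]: "labels (map_lfm f g h \<phi>) = labels \<phi>"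
  by (cases \<phi>) auto

lemma fresh_map [simp]:
  "fresh v (image_mset (map_lfm f g h) \<Gamma>) (image_mset (map_lfm f g h) \<Delta>) \<longleftrightarrow> fresh v \<Gamma> \<Delta>"
  by (auto simp: fresh_def ball_Un)

text \<open>
  The renaming need not be injective: initial sequents remain initial, no rule asks
  symbols to be distinct, and labels, hence the freshness conditions, are untouched.
\<close>

lemma G3_map:
  assumes "G3 L CS \<Gamma> \<Delta>"
  shows "G3 L (map_fm f g h ` CS) (image_mset (map_lfm f g h) \<Gamma>) (image_mset (map_lfm f g h) \<Delta>)"
  using assms
proof induction
  case (InitP w P \<Gamma> \<Delta>)
  then show ?case by simp (rule G3.InitP, simp)
next
  case (InitBot w \<Gamma> \<Delta>)
  then show ?case by simp (rule G3.InitBot, simp)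
next
  case (InitR w v \<Gamma> \<Delta>)
  then show ?case by simp (rule G3.InitR, simp)
next
  case (InitE w t A \<Gamma> \<Delta>)
  then show ?case by simp (rule G3.InitE, simp)
next
  case (RJust w v t A \<Gamma> \<Delta>)
  have "fresh v (image_mset (map_lfm f g h) (add_mset (Ev w t A) \<Gamma>))
      (image_mset (map_lfm f g h) (add_mset (Lab w (Just t A)) \<Delta>))"
    unfolding fresh_map by (rule RJust.hyps(2))
  with RJust.IH show ?case by simp (rule G3.RJust)
next
  case (AN c F w \<Gamma> \<Delta>)
  have "Just (JConst (g c)) (map_fm f g h F) \<in> map_fm f g h ` CS"
    using AN(1) by force
  from G3.AN[OF this] AN.IH show ?case by simp
next
  case (Ser w v \<Gamma> \<Delta>)
  from Ser.IH Ser.hyps show ?case by - (rule G3.Ser[where w = w and v = v], simp_all)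
next
  case LNeg
  then show ?case by simp (rule G3.LNeg)
next
  case RNeg
  then show ?case by simp (rule G3.RNeg)
next
  case LCon
  then show ?case by simp (rule G3.LCon)
next
  case RCon
  then show ?case by simp (rule G3.RCon)
next
  case LDis
  then show ?case by simp (rule G3.LDis)
next
  case RDis
  then show ?case by simp (rule G3.RDis)
next
  case LImp
  then show ?case by simp (rule G3.LImp)
next
  case RImp
  then show ?case by simp (rule G3.RImp)
next
  case LJust
  then show ?case by simp (rule G3.LJust)
next
  case E
  then show ?case by simp (rule G3.E)
next
  case ElPlus
  then show ?case by simp (rule G3.ElPlus)
next
  case ErPlus
  then show ?case by simp (rule G3.ErPlus)
next
  case EApp
  then show ?case by simp (rule G3.EApp)
next
  case EBang
  then show ?case by simp (rule G3.EBang)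
next
  case Mon
  then show ?case by simp (rule G3.Mon)
next
  case Trans
  then show ?case by simp (rule G3.Trans)
next
  case (Ref w)
  from G3.Ref[OF Ref.hyps(1)] Ref.IH show ?case by simp
qed

definition pull_model ::
    "('x \<Rightarrow> 'y) \<Rightarrow> ('c \<Rightarrow> 'd) \<Rightarrow> ('p \<Rightarrow> 'q) \<Rightarrow> ('w, 'y, 'd, 'q) model \<Rightarrow> ('w, 'x, 'c, 'p) model" where
  "pull_model f g h M = \<lparr>worlds = worlds M, acc = acc M,
     evid = \<lambda>t A. evid M (map_tm f g t) (map_fm f g h A), val = \<lambda>P. val M (h P)\<rparr>"

lemma pull_model_sel [simp]:
  "worlds (pull_model f g h M) = worlds M"
  "acc (pull_model f g h M) = acc M"
  "evid (pull_model f g h M) t A = evid M (map_tm f g t) (map_fm f g h A)"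
  "val (pull_model f g h M) P = val M (h P)"
  by (simp_all add: pull_model_def)

lemma forces_pull [simp]: "forces (pull_model f g h M) w A \<longleftrightarrow> forces M w (map_fm f g h A)"
  by (induction A arbitrary: w) auto

lemma validates_pull [simp]:
  "validates (pull_model f g h M) i \<phi> \<longleftrightarrow> validates M i (map_lfm f g h \<phi>)"
  by (cases \<phi>) auto

lemma valid_in_pull:
  "valid_in (pull_model f g h M) \<Gamma> \<Delta> \<longleftrightarrow>
    valid_in M (image_mset (map_lfm f g h) \<Gamma>) (image_mset (map_lfm f g h) \<Delta>)"
  by (simp add: valid_in_def interpretation_in_def)

text \<open>
  Terms and formulas commute with renaming, so each closure condition on evidence of
  \<open>M\<close> specializes to that of the pulled back model.
\<close>

lemma fitting_pull:
  assumes M: "fitting_model L (map_fm f g h ` CS) M"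
  shows "fitting_model L CS (pull_model f g h M)"
proof -
  have basic: "worlds M \<noteq> {}" "acc M \<subseteq> worlds M \<times> worlds M" "\<forall>P. val M P \<subseteq> worlds M"
    and frame: "has_jT L \<longrightarrow> (\<forall>w\<in>worlds M. (w, w) \<in> acc M)"
      "has_jD L \<longrightarrow> (\<forall>w\<in>worlds M. \<exists>v\<in>worlds M. (w, v) \<in> acc M)"
    and const: "\<forall>c F. Just (JConst c) F \<in> map_fm f g h ` CS \<longrightarrow> evid M (JConst c) F = worlds M"
    and evid: "\<forall>t\<in>Tm L. \<forall>A\<in>Fm L. evid M t A \<subseteq> worlds M"
      "\<forall>s\<in>Tm L. \<forall>t\<in>Tm L. \<forall>A\<in>Fm L. \<forall>B\<in>Fm L.
        evid M s (Imp A B) \<inter> evid M t A \<subseteq> evid M (App s t) B"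
      "\<forall>s\<in>Tm L. \<forall>t\<in>Tm L. \<forall>A\<in>Fm L. evid M s A \<union> evid M t A \<subseteq> evid M (Plus s t) A"
    and j4: "has_j4 L \<longrightarrow> trans (acc M) \<and>
       (\<forall>t\<in>Tm L. \<forall>A\<in>Fm L. \<forall>w v. w \<in> evid M t A \<and> (w, v) \<in> acc M \<longrightarrow> v \<in> evid M t A) \<and>
       (\<forall>t\<in>Tm L. \<forall>A\<in>Fm L. evid M t A \<subseteq> evid M (Bang t) (Just t A))"
    using M unfolding fitting_model_def by - (elim conjE, assumption)+
  have const_back: "evid M (JConst (g c)) (map_fm f g h F) = worlds M" if "Just (JConst c) F \<in> CS" for c F
    using const imageI[OF that, of "map_fm f g h"] by simp
  note rules = basic(1,2) basic(3)[rule_format] frame[rule_format] evid[rule_format]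
    j4[rule_format, THEN conjunct1] j4[rule_format, THEN conjunct2, THEN conjunct1, rule_format]
    j4[rule_format, THEN conjunct2, THEN conjunct2, rule_format]
  show ?thesis
    unfolding fitting_model_def pull_model_sel tm.map fm.map
    by (intro conjI ballI allI impI; rule rules const_back; (assumption | simp))
qed

lemma finite_symbols_tm [simp]: "finite (set1_tm t)" "finite (set2_tm t)"
  by (induction t) auto

lemma finite_symbols_fm [simp]: "finite (set1_fm A)" "finite (set2_fm A)" "finite (set3_fm A)"
  by (induction A) auto

lemma finite_symbols_lfm [simp]: "finite (set1_lfm \<phi>)" "finite (set2_lfm \<phi>)" "finite (set3_lfm \<phi>)"
  by (cases \<phi>; simp)+

lemma Axioms_in_Fm: "A \<in> Axioms L \<Longrightarrow> A \<in> Fm L"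
  by (induction rule: Axioms.induct) auto

lemma constant_specification_in_Fm:
  assumes "constant_specification L CS" and "A \<in> CS"
  shows "A \<in> Fm L"
proof -
  have "const_chain cs B \<in> Fm L" if "B \<in> Fm L" for cs and B :: "('a, 'b, 'c) fm"
    using that by (induction cs) (auto simp: const_chain_def)
  note chain = this
  show ?thesis
  proof (cases "has_j4 L")
    case True
    with assms obtain c B where "A = Just (JConst c) B" "B \<in> Axioms L"
      unfolding constant_specification_def by auto
    then show ?thesis using Axioms_in_Fm by simp
  next
    case False
    with assms have "A \<in> {const_chain cs B |cs B. cs \<noteq> [] \<and> B \<in> Axioms L}"
      unfolding constant_specification_def by (simp only: if_False) blast
    then show ?thesis using chain Axioms_in_Fm by auto
  qed
qed

theorem corollary8p3:
  fixes L :: logic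
    and CS :: "('x, 'c, 'p) fm set"
    and \<Gamma> \<Delta> :: "('x, 'c, 'p) lfm multiset"
  assumes "constant_specification L CS"
    and "finite CS"
    and "sequent L \<Gamma> \<Delta>"
    and "infinite (UNIV :: 'w set)"
    and "\<forall>M :: ('w, 'x, 'c, 'p) model. fitting_model L CS M \<longrightarrow> valid_in M \<Gamma> \<Delta>"
  shows "G3 L CS \<Gamma> \<Delta>"
proof -
  define X where "X = (\<Union>A\<in>CS. set1_fm A) \<union> (\<Union>\<phi>\<in>set_mset (\<Gamma> + \<Delta>). set1_lfm \<phi>)"
  define C where "C = (\<Union>A\<in>CS. set2_fm A) \<union> (\<Union>\<phi>\<in>set_mset (\<Gamma> + \<Delta>). set2_lfm \<phi>)"
  define Q where "Q = (\<Union>A\<in>CS. set3_fm A) \<union> (\<Union>\<phi>\<in>set_mset (\<Gamma> + \<Delta>). set3_lfm \<phi>)"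
  have "finite X" and "finite C" and "finite Q"
    using assms(2) by (simp_all add: X_def C_def Q_def)
  obtain f :: "'x \<Rightarrow> nat" where f: "inj_on f X"
    using finite_imp_inj_to_nat_seg[OF \<open>finite X\<close>] by blast
  obtain g :: "'c \<Rightarrow> nat" where g: "inj_on g C"
    using finite_imp_inj_to_nat_seg[OF \<open>finite C\<close>] by blast
  obtain h :: "'p \<Rightarrow> nat" where h: "inj_on h Q"
    using finite_imp_inj_to_nat_seg[OF \<open>finite Q\<close>] by blast
  \<comment> \<open>Decoding, arbitrary outside the codes of the occurring symbols.\<close>
  define f' g' h' where "f' = inv_into X f" and "g' = inv_into C g" and "h' = inv_into Q h"
  have inv: "\<And>x. x \<in> X \<Longrightarrow> f' (f x) = x" "\<And>c. c \<in> C \<Longrightarrow> g' (g c) = c"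
      "\<And>P. P \<in> Q \<Longrightarrow> h' (h P) = P"
    using f g h by (simp_all add: f'_def g'_def h'_def)
  let ?F = "map_fm f g h" and ?l = "map_lfm f g h"
  let ?F' = "map_fm f' g' h'" and ?l' = "map_lfm f' g' h'"
  have "?F' (?F A) = A" if A: "A \<in> CS" for A
  proof -
    have "set1_fm A \<subseteq> X" "set2_fm A \<subseteq> C" "set3_fm A \<subseteq> Q"
      using A by (auto simp: X_def C_def Q_def)
    then show ?thesis
      unfolding fm.map_comp by (intro fm.map_ident_strong) (auto simp: inv subset_iff)
  qed
  then have CS_back: "?F' ` ?F ` CS = CS" by (force simp: image_image)
  have lfm_back: "?l' (?l \<phi>) = \<phi>" if \<phi>: "\<phi> \<in># \<Gamma> + \<Delta>" for \<phi>
  proof -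
    have "set1_lfm \<phi> \<subseteq> X" "set2_lfm \<phi> \<subseteq> C" "set3_lfm \<phi> \<subseteq> Q"
      using \<phi> by (auto simp: X_def C_def Q_def)
    then show ?thesis
      unfolding lfm.map_comp by (intro lfm.map_ident_strong) (auto simp: inv subset_iff)
  qed
  have \<Gamma>_back: "image_mset ?l' (image_mset ?l \<Gamma>) = \<Gamma>"
    unfolding multiset.map_comp by (rule multiset.map_ident_strong) (simp add: lfm_back)
  have \<Delta>_back: "image_mset ?l' (image_mset ?l \<Delta>) = \<Delta>"
    unfolding multiset.map_comp by (rule multiset.map_ident_strong) (simp add: lfm_back)
  have "G3 L (?F ` CS) (image_mset ?l \<Gamma>) (image_mset ?l \<Delta>)"
  proof (rule completeness_countable[where ?'w = 'w])
    fix c F assume "Just (JConst c) F \<in> ?F ` CS"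
    then obtain A where A: "A \<in> CS" "Just (JConst c) F = ?F A" by blast
    have "?F A \<in> Fm L" using constant_specification_in_Fm[OF assms(1) A(1)] by simp
    then show "F \<in> Fm L" unfolding A(2)[symmetric] by simp
  next
    show "sequent L (image_mset ?l \<Gamma>) (image_mset ?l \<Delta>)" using assms(3) by simp
    show "infinite (UNIV :: 'w set)" by (fact assms(4))
    fix M :: "('w, nat, nat, nat) model"
    assume "fitting_model L (?F ` CS) M"
    from assms(5)[rule_format, OF fitting_pull[OF this]]
    show "valid_in M (image_mset ?l \<Gamma>) (image_mset ?l \<Delta>)"
      unfolding valid_in_pull .
  qed
  from G3_map[OF this, of f' g' h'] show ?thesis
    unfolding CS_back \<Gamma>_back \<Delta>_back .
qed

end
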